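(* Let $n$ be a positive integer. The game graph $G(n,n)$ of Nim started from two heaps each of size $n$ has order $\frac{1}{2}(n^2+3n+2)$, size $\frac{1}{2}n(n+1)^2$, and metric dimension $\lceil \frac{n}{2}\rceil$.
   Context: Two-heap Nim: a position is a multiset $\{a,b\}$ of two heap sizes $a,b\ge 0$ (unordered, possibly equal; empty heaps are recorded as $0$). A move removes any positive number of stones from exactly one heap, i.e. replaces one of the two heap sizes by a strictly smaller nonnegative integer. The game graph $G(n,n)$ is the digraph whose vertices are all positions reachable from $\{n,n\}$ (including $\{n,n\}$ itself), with an arc from a position $p$ to a position $q$ whenever there is a legal move from $p$ to $q$ (each position, as a multiset, appears as one vertex, and there is at most one arc from $p$ to $q$). The order of a graph is its number of vertices; its size is its number of arcs. Signed distance: in a digraph, let $d(u,v)$ be the number of arcs in a shortest directed path from $u$ to $v$ ($\infty$ if there is none, $d(u,u)=0$). The signed distance is $$d_{\pm}(u,v)=\begin{cases} d(u,v) & \text{if there is a directed } uv\text{-path and } d(u,v)\le d(v,u),\\ -d(v,u) & \text{if there is a directed } vu\text{-path and } d(v,u)<d(u,v),\\ \infty & \text{if there is neither a directed } uv\text{-path nor a directed } vu\text{-path.}\end{cases}$$ Metric dimension: for an ordered set $S=(u_1,\dots,u_k)$ of vertices, the distance vector of a vertex $v$ is $(d_\pm(u_1,v),\dots,d_\pm(u_k,v))$. $S$ is a resolving set if distinct vertices of the graph have distinct distance vectors. The metric dimension is the minimum cardinality of a resolving set. *)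

theory Defs
  imports "Graph_Theory.Graph_Theory" "HOL-Library.Multiset"
begin

section \<open>Signed distance and metric dimension of a digraph\<close>

context wf_digraph
begin

text \<open>Number of arcs of a shortest directed path: the library's shortest-path cost, with all
  arcs of weight 1. It is \<open>\<infinity>\<close> if there is no directed path.\<close>

definition arc_dist :: "'a \<Rightarrow> 'a \<Rightarrow> ereal" where
  "arc_dist u v = \<mu> (\<lambda>_. 1) u v"

definition signed_dist :: "'a \<Rightarrow> 'a \<Rightarrow> ereal" where
  "signed_dist u v =
     (if u \<rightarrow>\<^sup>* v \<and> arc_dist u v \<le> arc_dist v u then arc_dist u v
      else if v \<rightarrow>\<^sup>* u \<and> arc_dist v u < arc_dist u v then - arc_dist v u
      else \<infinity>)"

definition dist_vector :: "'a list \<Rightarrow> 'a \<Rightarrow> ereal list" where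
  "dist_vector S v = map (\<lambda>u. signed_dist u v) S"

text \<open>Ordered sets of vertices are lists without repetition.\<close>

definition resolving :: "'a list \<Rightarrow> bool" where
  "resolving S \<longleftrightarrow> distinct S \<and> set S \<subseteq> verts G \<and> inj_on (dist_vector S) (verts G)"

definition metric_dimension :: nat where
  "metric_dimension = (LEAST k. \<exists>S. resolving S \<and> length S = k)"

end


section \<open>Two-heap Nim\<close>

text \<open>Since \<open>{#a, b#} = {#b, a#}\<close>, letting the second listed heap shrink covers moves in
  either heap.\<close>

definition nim_move :: "nat multiset \<Rightarrow> nat multiset \<Rightarrow> bool" where
  "nim_move p q \<longleftrightarrow> (\<exists>a b c. p = {#a, b#} \<and> c < b \<and> q = {#a, c#})"

definition nim_graph :: "nat \<Rightarrow> nat \<Rightarrow> (nat multiset, nat multiset \<times> nat multiset) pre_digraph" where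
  "nim_graph m n =
     \<lparr> verts = {p. nim_move\<^sup>*\<^sup>* {#m, n#} p},
       arcs = {(p, q). nim_move\<^sup>*\<^sup>* {#m, n#} p \<and> nim_move p q},
       tail = fst, head = snd \<rparr>"

lemma wf_digraph_nim_graph: "wf_digraph (nim_graph m n)"
  by unfold_locales (auto simp: nim_graph_def intro: rtranclp.rtrancl_into_rtrancl)

end

theory Submission
  imports Defs
begin

text \<open>Write positions as \<open>{a, b}\<close> with \<open>a \<le> b\<close>. Then \<open>{c, d}\<close> can be reached from \<open>{a, b}\<close> iff
  \<open>c \<le> a\<close> and \<open>d \<le> b\<close>, and it takes at most two moves, so signed distances lie in
  \<open>{0, 1, 2, -1, -2, \<infinity>}\<close>.

  Lower bound for the metric dimension: along the chain
  \<open>{0,0}, {0,1}, {1,1}, {1,2}, \<dots>, {n,n}\<close> the signed distance from a fixed vertex runs monotonically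
  through \<open>2, 1, (0 or \<infinity>), -1, -2\<close>, so it changes at most 4 times, whereas a resolving set has to
  separate all \<open>2 n\<close> consecutive pairs; hence \<open>2 n \<le> 4 k\<close>.

  Upper bound: the signed distance from \<open>{m, m}\<close> to \<open>{a, b}\<close> reveals how \<open>a\<close> and \<open>b\<close> each compare
  with \<open>m\<close>, and comparisons with all odd \<open>m \<le> n\<close> determine a number in \<open>{0..n}\<close>.\<close>

section \<open>Shortest-path lengths in a digraph\<close>

context wf_digraph
begin

text \<open>Reduces lower bounds on \<open>arc_dist\<close>, an infimum of walk costs, to lower
  bounds on the lengths of walks.\<close>

lemma awalk_cost_1: "awalk_cost (\<lambda>_. 1) p = real (length p)"
  by (induction p) auto

lemma arc_dist_refl:
  assumes "u \<in> verts G"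
  shows "arc_dist u u = 0"
proof (rule antisym)
  have "awalk u [] u" using assms by (simp add: awalk_Nil_iff)
  from min_cost_le_walk_cost[OF this] show "arc_dist u u \<le> 0"
    by (metis arc_dist_def awalk_cost_Nil zero_ereal_def)
  show "0 \<le> arc_dist u u"
    unfolding arc_dist_def \<mu>_def by (rule INF_greatest) (simp add: awalk_cost_1)
qed

lemma arc_dist_arc:
  assumes "u \<rightarrow> v" "u \<noteq> v"
  shows "arc_dist u v = 1"
proof (rule antisym)
  obtain e where e: "e \<in> arcs G" "arc_to_ends G e = (u, v)"
    using assms(1) by (auto simp: arc_to_ends_def)
  then have "awalk u [e] v"
    by (auto simp: awalk_simps arc_to_ends_def)
  from min_cost_le_walk_cost[OF this, of "\<lambda>_. 1"] show "arc_dist u v \<le> 1"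
    by (simp add: arc_dist_def one_ereal_def)
  have "1 \<le> length p" if "awalk u p v" for p
    using that assms(2) by (cases p) (auto simp: awalk_simps)
  then show "1 \<le> arc_dist u v"
    unfolding arc_dist_def \<mu>_def by (intro INF_greatest) (auto simp: awalk_cost_1)
qed

text \<open>The walk through \<open>w\<close> bounds the distance by 2; the other two hypotheses
  exclude walks of length 0 and 1.\<close>

lemma arc_dist_two_arcs:
  assumes "u \<rightarrow> w" "w \<rightarrow> v" "u \<noteq> v" "\<not> u \<rightarrow> v"
  shows "arc_dist u v = 2"
proof (rule antisym)
  obtain e f where e: "e \<in> arcs G" "arc_to_ends G e = (u, w)"
    and f: "f \<in> arcs G" "arc_to_ends G f = (w, v)"
    using assms(1,2) by (metis arc_to_ends_def reachableE)
  then have "awalk u [e, f] v"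
    by (auto simp: awalk_simps arc_to_ends_def)
  from min_cost_le_walk_cost[OF this, of "\<lambda>_. 1"] show "arc_dist u v \<le> 2"
    by (simp add: arc_dist_def)
  have "2 \<le> length p" if p: "awalk u p v" for p
  proof -
    have "\<not> length p = 0" using p assms(3) by (auto simp: awalk_simps)
    moreover have "\<not> length p = 1"
      using p assms(4) by (auto simp: awalk_simps length_Suc_conv in_arcs_imp_in_arcs_ends)
    ultimately show ?thesis by linarith
  qed
  then show "2 \<le> arc_dist u v"
    unfolding arc_dist_def \<mu>_def by (intro INF_greatest) (auto simp: awalk_cost_1)
qed

lemma arc_dist_unreachable: "\<not> u \<rightarrow>\<^sup>* v \<Longrightarrow> arc_dist u v = \<infinity>"
  unfolding arc_dist_def by (rule shortest_path_inf)

end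

section \<open>Moves and reachability in terms of sorted pairs\<close>

text \<open>Sorting is a normal form, so unordered positions can be handled as ordered
  pairs.\<close>

lemma pair_mset_eq_iff:
  fixes a b c d :: "'a :: linorder"
  assumes "a \<le> b" "c \<le> d"
  shows "{#a, b#} = {#c, d#} \<longleftrightarrow> a = c \<and> b = d"
  using assms by (auto simp: add_eq_conv_ex)

text \<open>The three disjuncts say which heap survives: for \<open>c = a\<close> the larger heap
  shrinks but remains the larger, for \<open>d = b\<close> the smaller heap shrinks, and for
  \<open>d = a\<close> the larger heap shrinks to at most \<open>a\<close>, so that the roles
  swap.\<close>

lemma nim_move_iff:
  assumes "a \<le> b" "c \<le> d"
  shows "nim_move {#a, b#} {#c, d#} \<longleftrightarrow>
    c \<le> a \<and> d \<le> b \<and> (c, d) \<noteq> (a, b) \<and> (c = a \<or> d = b \<or> d = a)"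
proof
  assume "nim_move {#a, b#} {#c, d#}"
  then obtain x y z where "{#a, b#} = {#x, y#}" "z < y" "{#c, d#} = {#x, z#}"
    unfolding nim_move_def by blast
  then show "c \<le> a \<and> d \<le> b \<and> (c, d) \<noteq> (a, b) \<and> (c = a \<or> d = b \<or> d = a)"
    using assms by (auto simp: add_eq_conv_ex)
next
  assume *: "c \<le> a \<and> d \<le> b \<and> (c, d) \<noteq> (a, b) \<and> (c = a \<or> d = b \<or> d = a)"
  have 1: "nim_move {#x, y#} {#x, z#}" if "z < y" for x y z
    using that unfolding nim_move_def by blast
  from * consider "c = a" "d < b" | "d = b" "c < a" | "d = a" "c < b"
    using assms by fastforce
  then show "nim_move {#a, b#} {#c, d#}"
    using 1[of d b a] 1[of c a b] 1[of c b a] by cases (simp_all add: add_mset_commute)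
qed

lemma nim_move_sortedE:
  assumes "nim_move {#a, b#} q" "a \<le> b"
  obtains c d where "q = {#c, d#}" "c \<le> d" "c \<le> a" "d \<le> b"
proof -
  obtain x y z where *: "{#a, b#} = {#x, y#}" "z < y" "q = {#x, z#}"
    using assms unfolding nim_move_def by blast
  show thesis
  \<comment> \<open>The shrunken heap \<open>z\<close> may fall below the untouched heap
    \<open>x\<close>, which decides the order of the new pair.\<close>
  proof (cases "x \<le> z")
    case True
    with * assms that[of x z] show thesis by (auto simp: add_eq_conv_ex)
  next
    case False
    with * assms that[of z x] show thesis by (auto simp: add_eq_conv_ex add_mset_commute)
  qed
qed

lemma nim_moves_sortedE:
  assumes "nim_move\<^sup>*\<^sup>* {#a, b#} q" "a \<le> b"
  obtains c d where "q = {#c, d#}" "c \<le> d" "c \<le> a" "d \<le> b"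
proof -
  from assms(1) have "\<exists>c d. q = {#c, d#} \<and> c \<le> d \<and> c \<le> a \<and> d \<le> b"
  proof induction
    case base
    then show ?case using assms(2) by blast
  next
    case (step p q)
    then obtain c d where p: "p = {#c, d#}" "c \<le> d" "c \<le> a" "d \<le> b" by blast
    with step.hyps(2) obtain c' d' where "q = {#c', d'#}" "c' \<le> d'" "c' \<le> c" "d' \<le> d"
      using nim_move_sortedE by metis
    moreover from this p have "c' \<le> a" "d' \<le> b" by linarith+
    ultimately show ?case by blast
  qed
  with that show thesis by blast
qed

lemma nim_moves_iff:
  assumes "a \<le> b" "c \<le> d"
  shows "nim_move\<^sup>*\<^sup>* {#a, b#} {#c, d#} \<longleftrightarrow> c \<le> a \<and> d \<le> b"
proof
  assume "nim_move\<^sup>*\<^sup>* {#a, b#} {#c, d#}"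
  then show "c \<le> a \<and> d \<le> b"
    using assms by (elim nim_moves_sortedE) (auto simp: pair_mset_eq_iff)
next
  assume *: "c \<le> a \<and> d \<le> b"
  \<comment> \<open>Lowering the smaller heap first keeps the intermediate pair sorted; either stage
    may be empty.\<close>
  have "nim_move\<^sup>*\<^sup>* {#a, b#} {#c, b#}"
    using * assms by (cases "c = a") (auto simp: nim_move_iff)
  moreover have "nim_move\<^sup>*\<^sup>* {#c, b#} {#c, d#}"
    using * assms by (cases "d = b") (auto simp: nim_move_iff)
  ultimately show "nim_move\<^sup>*\<^sup>* {#a, b#} {#c, d#}" by simp
qed

lemma verts_nim_graph: "verts (nim_graph n n) = {{#a, b#} | a b. a \<le> b \<and> b \<le> n}"
proof -
  have "p \<in> verts (nim_graph n n) \<longleftrightarrow> (\<exists>a b. p = {#a, b#} \<and> a \<le> b \<and> b \<le> n)" for p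
    by (auto simp: nim_graph_def nim_moves_iff elim!: nim_moves_sortedE)
  then show ?thesis by blast
qed

lemma pair_in_verts_nim_graph: "a \<le> b \<Longrightarrow> b \<le> n \<Longrightarrow> {#a, b#} \<in> verts (nim_graph n n)"
  by (auto simp: verts_nim_graph)

lemma arcs_nim_graph:
  "arcs (nim_graph n n) = Sigma (verts (nim_graph n n)) (\<lambda>p. {q. nim_move p q})"
  by (auto simp: nim_graph_def)

lemma nim_graph_dominates_iff:
  "u \<rightarrow>\<^bsub>nim_graph n n\<^esub> v \<longleftrightarrow> u \<in> verts (nim_graph n n) \<and> nim_move u v"
  by (force simp: nim_graph_def arcs_ends_def arc_to_ends_def)

lemma nim_graph_reachable_iff:
  assumes "u \<in> verts (nim_graph n n)"
  shows "u \<rightarrow>\<^sup>*\<^bsub>nim_graph n n\<^esub> v \<longleftrightarrow> nim_move\<^sup>*\<^sup>* u v"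
proof
  interpret wf_digraph "nim_graph n n" by (rule wf_digraph_nim_graph)
  show "nim_move\<^sup>*\<^sup>* u v" if "u \<rightarrow>\<^sup>*\<^bsub>nim_graph n n\<^esub> v"
    using that
  proof (induction rule: reachable_induct)
    case (step x y)
    then show ?case
      by (auto simp: nim_graph_dominates_iff intro: rtranclp.rtrancl_into_rtrancl)
  qed auto
  show "u \<rightarrow>\<^sup>*\<^bsub>nim_graph n n\<^esub> v" if "nim_move\<^sup>*\<^sup>* u v"
    using that
  proof induction
    case base
    then show ?case using assms by simp
  next
    case (step x y)
    then show ?case
      by (metis nim_graph_dominates_iff reachable_adj_trans reachable_in_verts(2))
  qed
qed

section \<open>Distances and signed distances between positions\<close>

lemma arc_dist_nim_graph:
  assumes "a \<le> b" "b \<le> n" "c \<le> d" "d \<le> n"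
  shows "wf_digraph.arc_dist (nim_graph n n) {#a, b#} {#c, d#} =
    (if c \<le> a \<and> d \<le> b then
       if c = a \<and> d = b then 0 else if c = a \<or> d = b \<or> d = a then 1 else 2
     else \<infinity>)"
proof -
  interpret wf_digraph "nim_graph n n" by (rule wf_digraph_nim_graph)
  note [simp] = nim_graph_dominates_iff nim_move_iff pair_in_verts_nim_graph
    nim_graph_reachable_iff nim_moves_iff pair_mset_eq_iff
  \<comment> \<open>The middle position lowers \<open>a\<close> to \<open>c\<close> first, as in the
    proof of \<open>nim_moves_iff\<close>.\<close>
  have "arc_dist {#a, b#} {#c, d#} = 2"
    if "c \<le> a" "d \<le> b" "\<not> (c = a \<or> d = b \<or> d = a)"
    using that assms by (intro arc_dist_two_arcs[where w = "{#c, b#}"]) auto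
  then show ?thesis
    using assms by (auto intro: arc_dist_refl arc_dist_arc arc_dist_unreachable)
qed

text \<open>Moves only remove stones, so distinct positions are never reachable from each other. At
  most one of the two distances is then finite, and it determines the sign.\<close>

lemma signed_dist_nim_graph:
  assumes "a \<le> b" "b \<le> n" "c \<le> d" "d \<le> n"
  shows "wf_digraph.signed_dist (nim_graph n n) {#a, b#} {#c, d#} =
    (if c = a \<and> d = b then 0
     else if c \<le> a \<and> d \<le> b then if c = a \<or> d = b \<or> d = a then 1 else 2
     else if a \<le> c \<and> b \<le> d then if a = c \<or> b = d \<or> b = c then -1 else -2
     else \<infinity>)"
  using assms
  by (auto simp: wf_digraph.signed_dist_def[OF wf_digraph_nim_graph] arc_dist_nim_graph
      nim_graph_reachable_iff pair_in_verts_nim_graph nim_moves_iff)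

section \<open>Order and size\<close>

text \<open>The larger heap comes first, so that the smaller one ranges over \<open>{..b}\<close>
  and counts become iterated sums.\<close>

lemma verts_nim_graph_image:
  "verts (nim_graph n n) = (\<lambda>(b, a). {#a, b#}) ` (SIGMA b:{..n}. {..b})"
  by (force simp: verts_nim_graph)

lemma inj_on_sorted_pair_mset:
  fixes n :: nat
  shows "inj_on (\<lambda>(b, a). {#a, b#}) (SIGMA b:{..n}. {..b})"
  by (auto simp: inj_on_def pair_mset_eq_iff)

lemma card_verts_nim_graph: "2 * card (verts (nim_graph n n)) = (n + 1) * (n + 2)"
proof -
  have "card (verts (nim_graph n n)) = (\<Sum>b\<le>n. b + 1)"
    by (simp add: verts_nim_graph_image card_image inj_on_sorted_pair_mset)
  also have "2 * \<dots> = (n + 1) * (n + 2)"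
    by (induction n) auto
  finally show ?thesis .
qed

text \<open>Shrinking \<open>b\<close> gives \<open>b\<close> results and shrinking \<open>a\<close>
  gives \<open>a\<close>; the two sets of results are disjoint for distinct heaps and coincide for
  equal ones.\<close>

lemma card_nim_moves:
  assumes "a \<le> b"
  shows "finite {q. nim_move {#a, b#} q}" (is "finite ?M")
    and "card {q. nim_move {#a, b#} q} = (if a = b then b else a + b)"
proof -
  have M: "?M = (\<lambda>c. {#a, c#}) ` {..<b} \<union> (\<lambda>c. {#b, c#}) ` {..<a}"
    by (fastforce simp: nim_move_def add_eq_conv_ex)
  then show "finite ?M" by simp
  have card: "card ((\<lambda>c. {#x, c#}) ` {..<y}) = y" for x y :: nat
    by (subst card_image) (auto simp: inj_on_def)
  show "card ?M = (if a = b then b else a + b)"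
  proof (cases "a = b")
    case True
    then have "?M = (\<lambda>c. {#b, c#}) ` {..<b}" using M by simp
    then show ?thesis using True card by simp
  next
    case False
    \<comment> \<open>A common result would contain both \<open>a\<close> and \<open>b\<close>,
      forcing \<open>c = b\<close> against \<open>c < b\<close>.\<close>
    then have "(\<lambda>c. {#a, c#}) ` {..<b} \<inter> (\<lambda>c. {#b, c#}) ` {..<a} = {}"
      by (auto simp: add_eq_conv_ex)
    then show ?thesis using False by (simp add: M card card_Un_disjoint)
  qed
qed

lemma card_arcs_nim_graph: "2 * card (arcs (nim_graph n n)) = n * (n + 1)\<^sup>2"
proof -
  have "card (arcs (nim_graph n n)) = (\<Sum>p\<in>verts (nim_graph n n). card {q. nim_move p q})"
    unfolding arcs_nim_graph
    by (rule card_SigmaI) (auto simp: verts_nim_graph_image card_nim_moves)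
  also have "\<dots> = (\<Sum>(b, a)\<in>(SIGMA b:{..n}. {..b}). if a = b then b else a + b)"
    unfolding verts_nim_graph_image sum.reindex[OF inj_on_sorted_pair_mset] 
    by (rule sum.cong) (use card_nim_moves(2)[of b b for b] in \<open>auto simp: card_nim_moves(2)\<close>)
  also have "\<dots> = (\<Sum>b\<le>n. \<Sum>a\<le>b. if a = b then b else a + b)"
    by (subst sum.Sigma) auto
  \<comment> \<open>The diagonal term \<open>a = b\<close> is split off.\<close>
  also have "\<dots> = (\<Sum>b\<le>n. b + (\<Sum>a<b. a + b))"
    by (simp add: lessThan_Suc_atMost[symmetric] add.commute)
  also have "2 * \<dots> = n * (n + 1)\<^sup>2"
  proof (induction n)
    case (Suc n)
    \<comment> \<open>Separate \<open>m\<close> and \<open>k\<close> keep the summand fixed during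
      the induction on \<open>m\<close>; adding \<open>m\<close> on the left avoids a subtraction of
      naturals.\<close>
    have "2 * (\<Sum>a<m. a + k) + m = m * m + 2 * m * k" for m k :: nat
      by (induction m) (auto simp: algebra_simps)
    from this[of "Suc n" "Suc n"] Suc show ?case
      by (simp add: algebra_simps power2_eq_square)
  qed simp
  finally show ?thesis .
qed

section \<open>Lower bound for the metric dimension\<close>

text \<open>The index \<open>t\<close> is the total number of stones: \<open>2 * i\<close> gives {i,
  i} and \<open>2 * i + 1\<close> gives {i, i+1}.\<close>

definition nim_chain :: "nat \<Rightarrow> nat multiset" where
  "nim_chain t = {#t div 2, (t + 1) div 2#}"

text \<open>For \<open>a = 0\<close> the truncated \<open>2*a-2\<close> and \<open>2*a-1\<close> only add spurious exceptions.\<close>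

lemma signed_dist_nim_chain_Suc:
  assumes "a \<le> b" "b \<le> n" "t < 2 * n"
    and "t \<notin> (if a = b then {2*a-2, 2*a-1, 2*a, 2*a+1} else {2*a-2, 2*a+1, 2*b-2, 2*b+1})"
  shows "wf_digraph.signed_dist (nim_graph n n) {#a, b#} (nim_chain t) =
         wf_digraph.signed_dist (nim_graph n n) {#a, b#} (nim_chain (Suc t))"
proof (cases "even t")
  case True
  then obtain i where "t = 2 * i" by blast
  then show ?thesis using assms
    by (auto simp: nim_chain_def signed_dist_nim_graph split: if_splits)
next
  case False
  then obtain i where "t = 2 * i + 1" by (rule oddE)
  then show ?thesis using assms
    by (auto simp: nim_chain_def signed_dist_nim_graph split: if_splits)
qed

lemma nim_resolving_length_ge:
  assumes "wf_digraph.resolving (nim_graph n n) S"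
  shows "n \<le> 2 * length S"
proof -
  interpret wf_digraph "nim_graph n n" by (rule wf_digraph_nim_graph)
  define D where "D u = {t. t < 2 * n \<and>
    signed_dist u (nim_chain t) \<noteq> signed_dist u (nim_chain (Suc t))}" for u
  have D: "card (D u) \<le> 4" if u: "u \<in> set S" for u
  proof -
    obtain a b where ab: "u = {#a, b#}" "a \<le> b" "b \<le> n"
      using u assms by (auto simp: resolving_def verts_nim_graph)
    \<comment> \<open>The chain contains \<open>a\<close> exactly for indices from
      \<open>2*a-1\<close> to \<open>2*a+1\<close>. For \<open>a < b\<close> the value can change
      only on entering or leaving this stretch or the one for \<open>b\<close>; for
      \<open>a = b\<close> it can also change just before and just after {a, a}.\<close>
    define T where "T = (if a = b then {2*a-2, 2*a-1, 2*a, 2*a+1}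
      else {2*a-2, 2*a+1, 2*b-2, 2*b+1})"
    have "D u \<subseteq> T"
      using signed_dist_nim_chain_Suc[OF ab(2,3)] unfolding D_def ab(1) T_def by blast
    then have "card (D u) \<le> card T"
      by (rule card_mono[rotated]) (simp add: T_def)
    \<comment> \<open>Entries of \<open>T\<close> may coincide, for instance when
      \<open>a = 0\<close>, so only an upper bound holds.\<close>
    also have "card {w, x, y, z} \<le> 4" for w x y z :: nat
      using card_length[of "[w, x, y, z]"] by simp
    then have "card T \<le> 4" by (simp add: T_def)
    finally show ?thesis .
  qed
  have "{..<2 * n} \<subseteq> (\<Union>u\<in>set S. D u)"
  proof
    fix t assume t: "t \<in> {..<2 * n}"
    have "nim_chain t \<in> verts (nim_graph n n)" "nim_chain (Suc t) \<in> verts (nim_graph n n)"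
      using t by (auto simp: nim_chain_def intro!: pair_in_verts_nim_graph)
    moreover have "nim_chain t \<noteq> nim_chain (Suc t)"
      by (auto simp: nim_chain_def pair_mset_eq_iff)
    ultimately have "dist_vector S (nim_chain t) \<noteq> dist_vector S (nim_chain (Suc t))"
      using assms by (auto simp: resolving_def dest: inj_onD)
    then show "t \<in> (\<Union>u\<in>set S. D u)" using t by (auto simp: dist_vector_def D_def)
  qed
  then have "2 * n \<le> card (\<Union>u\<in>set S. D u)"
    using card_mono[of "\<Union>u\<in>set S. D u" "{..<2 * n}"] by (auto simp: D_def)
  also have "\<dots> \<le> (\<Sum>u\<in>set S. card (D u))" by (rule card_UN_le) simp
  also have "\<dots> \<le> card (set S) * 4" using sum_bounded_above[of "set S" "\<lambda>u. card (D u)" 4] D by simp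
  also have "\<dots> \<le> length S * 4" using card_length by simp
  finally show ?thesis by simp
qed

section \<open>Upper bound for the metric dimension\<close>

text \<open>There are \<open>(n + 1) div 2\<close> odd numbers up to \<open>n\<close>.\<close>

definition odd_diagonal :: "nat \<Rightarrow> nat multiset list" where
  "odd_diagonal n = map (\<lambda>k. {#2 * k + 1, 2 * k + 1#}) [0..<(n + 1) div 2]"

text \<open>The six values encode the six possible patterns: 0 for \<open>a = b = m\<close>, 1 for
  \<open>a < b = m\<close>, 2 for \<open>b < m\<close>, -1 for \<open>a = m < b\<close>, -2 for
  \<open>m < a\<close>, and infinity for \<open>a < m < b\<close>.\<close>

lemma signed_dist_diagonal_eqD:
  assumes "m \<le> n" "a \<le> b" "b \<le> n" "c \<le> d" "d \<le> n"
    and "wf_digraph.signed_dist (nim_graph n n) {#m, m#} {#a, b#} =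
         wf_digraph.signed_dist (nim_graph n n) {#m, m#} {#c, d#}"
  shows "(a < m \<longleftrightarrow> c < m) \<and> (a = m \<longleftrightarrow> c = m) \<and> (b < m \<longleftrightarrow> d < m) \<and> (b = m \<longleftrightarrow> d = m)"
  using assms by (auto simp: signed_dist_nim_graph one_ereal_def split: if_splits)

text \<open>If \<open>a < c\<close>, the odd one of \<open>a\<close> and \<open>a + 1\<close>
  separates them: equality with \<open>m = a\<close> singles out \<open>a\<close>, and
  \<open>m = a + 1\<close> is at most \<open>c\<close>, hence at most \<open>n\<close>, and exceeds
  only \<open>a\<close>.\<close>

lemma eq_if_same_side_of_odds:
  fixes a c n :: nat
  assumes "a \<le> n" "c \<le> n"
    and "\<And>m. odd m \<Longrightarrow> m \<le> n \<Longrightarrow> (a < m \<longleftrightarrow> c < m) \<and> (a = m \<longleftrightarrow> c = m)"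
  shows "a = c"
  using assms
proof (induction a c rule: linorder_wlog)
  case (le a c)
  show ?case
  proof (rule ccontr)
    assume "a \<noteq> c"
    then show False
      using le.hyps le.prems le.prems(3)[of a] le.prems(3)[of "a + 1"] by (cases "odd a") auto
  qed
next
  case (sym a c)
  then show ?case by metis
qed

lemma resolving_odd_diagonal: "wf_digraph.resolving (nim_graph n n) (odd_diagonal n)"
proof -
  interpret wf_digraph "nim_graph n n" by (rule wf_digraph_nim_graph)
  have "p = q" if pq: "p \<in> verts (nim_graph n n)" "q \<in> verts (nim_graph n n)"
    and eq: "dist_vector (odd_diagonal n) p = dist_vector (odd_diagonal n) q" for p q
  proof -
    obtain a b c d where p: "p = {#a, b#}" "a \<le> b" "b \<le> n" and q: "q = {#c, d#}" "c \<le> d" "d \<le> n"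
      using pq by (auto simp: verts_nim_graph)
    have *: "(a < m \<longleftrightarrow> c < m) \<and> (a = m \<longleftrightarrow> c = m) \<and> (b < m \<longleftrightarrow> d < m) \<and> (b = m \<longleftrightarrow> d = m)"
      if m: "odd m" "m \<le> n" for m
    proof -
      obtain k where "m = 2 * k + 1" using m(1) by (rule oddE)
      then have "{#m, m#} \<in> set (odd_diagonal n)" using m(2) by (auto simp: odd_diagonal_def)
      then have "signed_dist {#m, m#} p = signed_dist {#m, m#} q"
        using eq unfolding dist_vector_def map_eq_conv by blast
      then show ?thesis
        using m(2) p q by (intro signed_dist_diagonal_eqD) auto
    qed
    have "a = c" by (rule eq_if_same_side_of_odds[of _ n]) (use * p q in auto)
    moreover have "b = d" by (rule eq_if_same_side_of_odds[of _ n]) (use * p q in auto)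
    ultimately show ?thesis using p q by simp
  qed
  moreover have "distinct (odd_diagonal n)"
    by (auto simp: odd_diagonal_def distinct_map inj_on_def pair_mset_eq_iff)
  moreover have "set (odd_diagonal n) \<subseteq> verts (nim_graph n n)"
    by (auto simp: odd_diagonal_def intro!: pair_in_verts_nim_graph)
  ultimately show ?thesis
    unfolding resolving_def inj_on_def by blast
qed

section \<open>The exact metric dimension and the three formulas\<close>

lemma metric_dimension_nim_graph:
  "wf_digraph.metric_dimension (nim_graph n n) = (n + 1) div 2"
proof -
  interpret wf_digraph "nim_graph n n" by (rule wf_digraph_nim_graph)
  show ?thesis
    unfolding metric_dimension_def
  proof (rule Least_equality)
    show "\<exists>S. resolving S \<and> length S = (n + 1) div 2"
      using resolving_odd_diagonal[of n] by (auto simp: odd_diagonal_def)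
    \<comment> \<open>Since \<open>k\<close> is an integer, \<open>n \<le> 2 * k\<close> already
      gives the rounded-up bound.\<close>
    show "(n + 1) div 2 \<le> k" if "\<exists>S. resolving S \<and> length S = k" for k
      using that nim_resolving_length_ge by fastforce
  qed
qed

theorem theorem3p2:
  fixes n :: nat
  assumes "n > 0"
  shows "real (card (verts (nim_graph n n))) = 1 / 2 * (real n ^ 2 + 3 * real n + 2) \<and>
         real (card (arcs (nim_graph n n))) = 1 / 2 * real n * (real n + 1) ^ 2 \<and>
         int (wf_digraph.metric_dimension (nim_graph n n)) = \<lceil>real n / 2\<rceil>"
proof (intro conjI)
  have "2 * real (card (verts (nim_graph n n))) = (real n + 1) * (real n + 2)"
    using card_verts_nim_graph[of n, THEN arg_cong[where f = real]] by (simp add: algebra_simps)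
  then show "real (card (verts (nim_graph n n))) = 1 / 2 * (real n ^ 2 + 3 * real n + 2)"
    by (simp add: algebra_simps power2_eq_square)
  have "2 * real (card (arcs (nim_graph n n))) = real n * (real n + 1) ^ 2"
    using card_arcs_nim_graph[of n, THEN arg_cong[where f = real]]
    by (simp add: algebra_simps power2_eq_square)
  then show "real (card (arcs (nim_graph n n))) = 1 / 2 * real n * (real n + 1) ^ 2"
    by simp
  have "\<lceil>real n / 2\<rceil> = int ((n + 1) div 2)"
  proof (cases "even n")
    case True
    then show ?thesis by (auto elim!: evenE)
  next
    case False
    then obtain k where "n = 2 * k + 1" by (rule oddE)
    then show ?thesis by (simp add: ceiling_unique add_divide_distrib)
  qed
  then show "int (wf_digraph.metric_dimension (nim_graph n n)) = \<lceil>real n / 2\<rceil>"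
    by (simp add: metric_dimension_nim_graph)
qed

end
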